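(* Let $c>0$ be a constant and let $X(\cdot)$ be a nonnegative function on $(0,\infty)$ such that $$X'(t)=\frac{dX(t)}{dt}\le 0\quad\text{and}\quad \frac{d\big(e^{ct}X(t)\big)}{dt}\le 0\quad\text{for } t>0.$$ For $p\in[0,\infty)$ let $Y_p(t)=-\int_t^\infty r^p\,dX(r)$ be defined for $t\in[0,\infty)$ in the sense of Riemann-Stieltjes integration. (i) If $0\le p_1<p_2<\infty$, then $$\frac{c^{p_2}Y_{p_2}(0)}{\Gamma(p_2+1)}\le\frac{c^{p_1}Y_{p_1}(0)}{\Gamma(p_1+1)}.$$ Moreover, $$\frac{c^{p_2}Y_{p_2}(0)}{\Gamma(p_2+1)}=\frac{c^{p_1}Y_{p_1}(0)}{\Gamma(p_1+1)}<\infty$$ if and only if $$X(0):=\lim_{r\to0^+}X(r)<\infty\quad\text{and}\quad X(t)=e^{-ct}X(0)\ \text{ for all } t\ge 0.$$ (ii) If $Y_{p_0}(0)<\infty$ for some $p_0\in[0,\infty)$, then $$\lim_{t\to\infty}e^{ct}X(t)=\lim_{p\to\infty}\frac{c^pY_p(0)}{\Gamma(p+1)}.$$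
   Context: $\Gamma$ is the classical gamma function. The integrals defining $Y_p(t)$ are improper (at $\infty$, and at $0$ when $t=0$); since $X$ is nonincreasing they are well defined with values in $[0,\infty]$. *)

theory Defs
  imports "HOL-Analysis.Analysis"
begin

text \<open>Riemann--Stieltjes integral of f with respect to g over [a, b], as the limit of the sums
  of f x (g v - g u) over tagged divisions with cells [u, v] and tags x, as the mesh tends to 0.
  The radius d does not depend on the tag (this is the Riemann, not the gauge, integral), and
  a cell K containing its tag x is included in ball x d if its length is less than d, and has
  length at most 2d if it is included in that ball.\<close>

definition has_rs_integral ::
    "(real \<Rightarrow> real) \<Rightarrow> (real \<Rightarrow> real) \<Rightarrow> real \<Rightarrow> real \<Rightarrow> real \<Rightarrow> bool" where
  "has_rs_integral f g a b I \<longleftrightarrow>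
     (\<forall>e>0. \<exists>d>0. \<forall>D. D tagged_division_of {a..b} \<and> (\<lambda>x. ball x d) fine D \<longrightarrow>
        \<bar>(\<Sum>(x, K)\<in>D. f x * (g (Sup K) - g (Inf K))) - I\<bar> < e)"

definition rs_integral ::
    "(real \<Rightarrow> real) \<Rightarrow> (real \<Rightarrow> real) \<Rightarrow> real \<Rightarrow> real \<Rightarrow> real" where
  "rs_integral f g a b = (THE I. has_rs_integral f g a b I)"

lemma has_rs_integral_unique:
  assumes I: "has_rs_integral f g a b I" and J: "has_rs_integral f g a b J"
  shows "I = J"
proof (rule ccontr)
  assume "I \<noteq> J"
  define e where "e = \<bar>I - J\<bar> / 2"
  have "e > 0" using \<open>I \<noteq> J\<close> by (simp add: e_def)
  obtain d where d: "d > 0" "\<And>D. D tagged_division_of {a..b} \<Longrightarrow> (\<lambda>x. ball x d) fine D \<Longrightarrow>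
      \<bar>(\<Sum>(x, K)\<in>D. f x * (g (Sup K) - g (Inf K))) - I\<bar> < e"
    using I \<open>e > 0\<close> unfolding has_rs_integral_def by meson
  obtain d' where d': "d' > 0" "\<And>D. D tagged_division_of {a..b} \<Longrightarrow> (\<lambda>x. ball x d') fine D \<Longrightarrow>
      \<bar>(\<Sum>(x, K)\<in>D. f x * (g (Sup K) - g (Inf K))) - J\<bar> < e"
    using J \<open>e > 0\<close> unfolding has_rs_integral_def by meson
  have "gauge (\<lambda>x::real. ball x (min d d'))" using d d' by (intro gauge_ball) simp
  then obtain D where D: "D tagged_division_of {a..b}" "(\<lambda>x. ball x (min d d')) fine D"
    by (rule fine_division_exists_real)
  have fd: "(\<lambda>x. ball x d) fine D" and fd': "(\<lambda>x. ball x d') fine D"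
    using D(2) by (fastforce simp: fine_def)+
  show False
    using d(2)[OF D(1) fd] d'(2)[OF D(1) fd'] unfolding e_def by argo
qed

lemma rs_integral_eqI: "has_rs_integral f g a b I \<Longrightarrow> rs_integral f g a b = I"
  unfolding rs_integral_def by (blast intro: has_rs_integral_unique)

text \<open>The integral from t to infinity is improper at infinity and, for t = 0, also at 0, where
  the integrator need not be bounded. For t >= 0 no value of g outside (0, infinity) is used.\<close>

definition improper_rs_integral :: "(real \<Rightarrow> real) \<Rightarrow> (real \<Rightarrow> real) \<Rightarrow> real \<Rightarrow> ereal" where
  "improper_rs_integral f g t =
     (if t = 0
      then Lim (at_right 0 \<times>\<^sub>F at_top) (\<lambda>(a, b). ereal (rs_integral f g a b))
      else Lim at_top (\<lambda>b. ereal (rs_integral f g t b)))"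

definition Y :: "(real \<Rightarrow> real) \<Rightarrow> real \<Rightarrow> real \<Rightarrow> ereal" where
  "Y X p t = - improper_rs_integral (\<lambda>r. r powr p) X t"

end

theory Submission
  imports Defs "HOL-Real_Asymp.Real_Asymp"
begin

text \<open>The function $Z(t) = e^{ct} X(t)$ is nonincreasing. Integration by parts turns
  $c^p Y_p(0) / \Gamma(p+1)$ into the mean $W(p)$ of $Z$ under the gamma density of shape $p$ and
  rate $c$ (for $p = 0$, into $Z(0+)$). Of two densities with shapes $p < q$, the second is
  smaller up to a single crossing point and larger beyond it, so the mean of the nonincreasing $Z$
  decreases in the shape, strictly if it is finite and $Z$ is not constant. As $p \to \infty$ the mass escapes to infinity, so the mean tends to $Z(\infty)$; its
  part over $(0, R]$ is dominated by $(cR)^n \Gamma(q) / \Gamma(q+n)$ times a fixed finite mean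
  $W(q)$.\<close>

text \<open>Two features of \<open>X\<close> shape the argument. Its derivative exists but need not
  be continuous, so the existence of the Stieltjes integral is not the textbook case; integration by
  parts settles it and leaves a formula free of the derivative. And \<open>X\<close> may be
  unbounded at 0, so the means may be infinite: \<open>W\<close> takes values in
  \<open>ennreal\<close>, means are compared without being subtracted, and the equality case needs
  finiteness. Strictness becomes the stated characterisation because \<open>Z\<close> is constant
  exactly when X(t) = exp(-ct) X(0).\<close>

section \<open>Integration by parts for Riemann-Stieltjes integrals\<close>

text \<open>\<open>g'\<close> may be discontinuous: \<open>f * g'\<close> is integrable because it
  is the derivative of \<open>f * g\<close> minus the continuous function \<open>f' * g\<close>. The
  sign of \<open>g'\<close> takes the place of a bounded-variation hypothesis, the variation of
  \<open>g\<close> on the interval being \<open>g a - g b\<close>.\<close>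

lemma has_rs_integral_by_parts:
  fixes f g f' g' :: "real \<Rightarrow> real"
  assumes "a \<le> b"
    and f: "\<And>x. x \<in> {a..b} \<Longrightarrow> (f has_real_derivative f' x) (at x)"
    and g: "\<And>x. x \<in> {a..b} \<Longrightarrow> (g has_real_derivative g' x) (at x)"
    and f': "continuous_on {a..b} f'"
    and g': "\<And>x. x \<in> {a..b} \<Longrightarrow> g' x \<le> 0"
  shows "has_rs_integral f g a b
           (f b * g b - f a * g a - integral {a..b} (\<lambda>x. f' x * g x))"
proof -
  have contf: "continuous_on {a..b} f"
    by (rule continuous_at_imp_continuous_on) (blast intro: DERIV_isCont[OF f])
  have contg: "continuous_on {a..b} g"
    by (rule continuous_at_imp_continuous_on) (blast intro: DERIV_isCont[OF g])
  have "((\<lambda>x. f' x * g x + f x * g' x) has_integral f b * g b - f a * g a) {a..b}"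
  proof (rule fundamental_theorem_of_calculus[OF \<open>a \<le> b\<close>])
    fix x assume "x \<in> {a..b}"
    from DERIV_mult[OF f[OF this] g[OF this]]
    show "((\<lambda>x. f x * g x) has_vector_derivative f' x * g x + f x * g' x) (at x within {a..b})"
      by (simp add: has_real_derivative_iff_has_vector_derivative has_vector_derivative_at_within
          mult.commute)
  qed
  moreover have "(\<lambda>x. f' x * g x) integrable_on {a..b}"
    by (intro integrable_continuous_interval continuous_intros f' contg)
  ultimately have "((\<lambda>x. (f' x * g x + f x * g' x) - f' x * g x) has_integral
      f b * g b - f a * g a - integral {a..b} (\<lambda>x. f' x * g x)) {a..b}"
    by (intro has_integral_diff) auto
  then have fg': "((\<lambda>x. f x * g' x) has_integral
      f b * g b - f a * g a - integral {a..b} (\<lambda>x. f' x * g x)) {a..b}" (is "(_ has_integral ?I) _")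
    by simp
  have FTC: "(g' has_integral g v - g u) {u..v}" if "a \<le> u" "u \<le> v" "v \<le> b" for u v
  proof (rule fundamental_theorem_of_calculus[OF \<open>u \<le> v\<close>])
    fix x assume "x \<in> {u..v}"
    then have "(g has_real_derivative g' x) (at x)" using that by (intro g) auto
    then show "(g has_vector_derivative g' x) (at x within {u..v})"
      by (simp add: has_real_derivative_iff_has_vector_derivative has_vector_derivative_at_within)
  qed
  have gab: "g b \<le> g a"
    using has_integral_nonneg[OF has_integral_neg[OF FTC[of a b]]] \<open>a \<le> b\<close> g' by simp
  show ?thesis
    unfolding has_rs_integral_def
  proof (intro allI impI)
    fix e :: real assume "e > 0"
    \<comment> \<open>\<open>g a - g b\<close> is the total variation of \<open>g\<close>, by which
      the cellwise error \<open>e'\<close> gets multiplied; the added 1 avoids division by zero and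
      makes the final bound strict.\<close>
    define e' where "e' = e / (1 + (g a - g b))"
    have "e' > 0" using \<open>e > 0\<close> gab by (simp add: e'_def add_pos_nonneg)
    have "e' * (g a - g b) < e"
      using \<open>e > 0\<close> gab by (simp add: e'_def field_simps)
    \<comment> \<open>Uniform continuity supplies one radius for all tags, as the Riemann form of
      the integral demands.\<close>
    have "uniformly_continuous_on {a..b} f"
      using contf by (simp add: compact_uniformly_continuous)
    then obtain d where "d > 0"
      and d: "\<And>x y. x \<in> {a..b} \<Longrightarrow> y \<in> {a..b} \<Longrightarrow> dist y x < d \<Longrightarrow> dist (f y) (f x) < e'"
      using \<open>e' > 0\<close> unfolding uniformly_continuous_on_def by metis
    show "\<exists>d>0. \<forall>D. D tagged_division_of {a..b} \<and> (\<lambda>x. ball x d) fine D \<longrightarrow>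
            \<bar>(\<Sum>(x, K)\<in>D. f x * (g (Sup K) - g (Inf K))) - ?I\<bar> < e"
    proof (intro exI[of _ d] conjI allI impI \<open>d > 0\<close>; elim conjE)
      fix D assume D: "D tagged_division_of {a..b}" and fine: "(\<lambda>x. ball x d) fine D"
      have cell: "\<bar>f x * (g (Sup K) - g (Inf K)) - integral K (\<lambda>x. f x * g' x)\<bar>
          \<le> e' * - integral K g'" if xK: "(x, K) \<in> D" for x K
      proof -
        obtain u v where K: "K = {u..v}" and "x \<in> K" and "K \<subseteq> {a..b}"
          using tagged_division_ofD(2,3,4)[OF D xK] by (metis box_real(2))
        then have uv: "a \<le> u" "u \<le> v" "v \<le> b" by auto
        have KB: "K \<subseteq> ball x d" using fine xK by (auto simp: fine_def)
        note FK = FTC[OF uv, folded K]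
        have int: "(\<lambda>r. f r * g' r) integrable_on K"
          using fg' \<open>K \<subseteq> {a..b}\<close> unfolding K
          by (meson has_integral_integrable integrable_on_subinterval)
        have ig: "integral K g' = g v - g u"
          using FK by (rule integral_unique)
        have int': "(\<lambda>r. k * g' r) integrable_on K" for k
          using has_integral_mult_right[OF FK] by (rule has_integral_integrable)
        \<comment> \<open>The tag value is a constant, and \<open>g'\<close> integrates over the
          cell to the increment of \<open>g\<close>. So the error on a cell is governed by the
          oscillation of \<open>f\<close> there, weighted by \<open>g'\<close>.\<close>
        have "f x * (g (Sup K) - g (Inf K)) - integral K (\<lambda>r. f r * g' r)
            = integral K (\<lambda>r. f x * g' r - f r * g' r)"
          using uv by (subst integral_diff[OF int' int]) (simp add: K ig[unfolded K])
        moreover have "norm (integral K (\<lambda>r. f x * g' r - f r * g' r)) \<le> integral K (\<lambda>r. e' * - g' r)"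
        proof (rule integral_norm_bound_integral)
          show "(\<lambda>r. f x * g' r - f r * g' r) integrable_on K"
            by (rule integrable_diff[OF int' int])
          show "(\<lambda>r. e' * - g' r) integrable_on K"
            using int'[of "- e'"] by simp
          fix r assume "r \<in> K"
          then have "\<bar>f x - f r\<bar> \<le> e'" "g' r \<le> 0"
            using d[of r x] \<open>x \<in> K\<close> \<open>K \<subseteq> {a..b}\<close> KB g' by (auto simp: dist_real_def subset_iff)
          then have "\<bar>f x - f r\<bar> * \<bar>g' r\<bar> \<le> e' * - g' r"
            by (intro mult_mono) auto
          then show "norm (f x * g' r - f r * g' r) \<le> e' * - g' r"
            by (simp add: abs_mult flip: left_diff_distrib)
        qed
        ultimately show ?thesis by simp
      qed
      have "(\<Sum>(x, K)\<in>D. integral K (\<lambda>x. f x * g' x)) = ?I"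
        using integral_combine_tagged_division_topdown[of "\<lambda>x. f x * g' x" a b D] fg' D
        by (simp add: has_integral_integrable_integral)
      then have "\<bar>(\<Sum>(x, K)\<in>D. f x * (g (Sup K) - g (Inf K))) - ?I\<bar>
          = \<bar>\<Sum>(x, K)\<in>D. f x * (g (Sup K) - g (Inf K)) - integral K (\<lambda>x. f x * g' x)\<bar>"
        by (simp add: sum_subtractf case_prod_unfold)
      also have "\<dots> \<le> (\<Sum>(x, K)\<in>D. e' * - integral K g')"
        using cell by (intro order_trans[OF sum_abs] sum_mono) auto
      also have "\<dots> = e' * - (\<Sum>(x, K)\<in>D. integral K g')"
        by (simp add: sum_distrib_left sum_negf case_prod_unfold)
      also have "(\<Sum>(x, K)\<in>D. integral K g') = g b - g a"
        using integral_combine_tagged_division_topdown[of g' a b D] FTC[of a b] D \<open>a \<le> b\<close>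
        by (simp add: has_integral_integrable_integral)
      also have "e' * - (g b - g a) < e"
        using \<open>e' * (g a - g b) < e\<close> by simp
      finally show "\<bar>(\<Sum>(x, K)\<in>D. f x * (g (Sup K) - g (Inf K))) - ?I\<bar> < e" .
    qed
  qed
qed

section \<open>Measure-theoretic tools on the half line\<close>

lemma AE_lborel_interval_ex:
  fixes a b :: real
  assumes "AE x in lborel. P x" "a < b"
  shows "\<exists>x\<in>{a<..<b}. P x"
proof (rule ccontr)
  assume "\<not> (\<exists>x\<in>{a<..<b}. P x)"
  then have "AE x in lborel. x \<notin> {a<..<b}"
    using assms(1) by (auto elim!: eventually_mono)
  then have "emeasure lborel {a<..<b} = 0"
    by (subst (asm) AE_iff_measurable[OF _ refl]) (auto simp: greaterThanLessThan_eq Int_def)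
  with \<open>a < b\<close> show False by simp
qed

text \<open>The difference \<open>v - u\<close> has integral 0, where finiteness makes it legitimate
  to subtract the integrals. This is what decides the equality cases between means of
  \<open>Z\<close>.\<close>

lemma nn_integral_eq_imp_AE_eq:
  fixes u v :: "'a \<Rightarrow> ennreal"
  assumes [measurable]: "u \<in> borel_measurable M" "v \<in> borel_measurable M"
    and le: "\<And>x. u x \<le> v x" and eq: "(\<integral>\<^sup>+x. u x \<partial>M) = (\<integral>\<^sup>+x. v x \<partial>M)"
    and fin: "(\<integral>\<^sup>+x. v x \<partial>M) < \<infinity>"
  shows "AE x in M. u x = v x"
proof -
  have "(\<integral>\<^sup>+x. v x - u x \<partial>M) = 0"
    using fin eq le by (subst nn_integral_diff) auto
  then have "AE x in M. v x - u x = 0"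
    by (subst (asm) nn_integral_0_iff_AE) auto
  moreover have "AE x in M. v x \<noteq> \<infinity>"
    using fin by (intro nn_integral_noteq_infinite) auto
  ultimately show ?thesis
  proof eventually_elim
    case (elim x)
    then show ?case using le[of x] by (simp add: ennreal_minus_eq_0 antisym)
  qed
qed

text \<open>Continuity from below handles one increasing sequence of intervals. Since the integral
  grows with the interval, the limit carries over to the product filter, in which the two endpoints
  move independently.\<close>

lemma tendsto_nn_integral_interval:
  fixes h :: "real \<Rightarrow> ennreal"
  assumes [measurable]: "h \<in> borel_measurable borel"
  shows "((\<lambda>(a, b). \<integral>\<^sup>+r. h r * indicator {a..b} r \<partial>lborel) \<longlongrightarrow>
           (\<integral>\<^sup>+r. h r * indicator {0<..} r \<partial>lborel)) (at_right (0::real) \<times>\<^sub>F at_top)"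
proof -
  \<comment> \<open>\<open>Suc n\<close> keeps the left end positive; \<open>A 0\<close> is empty,
    which does no harm.\<close>
  define A where "A = (\<lambda>n. {1 / real (Suc n)..real n})"
  have A: "incseq A" "(\<Union>n. A n) = {0<..}"
  proof -
    show "incseq A"
      unfolding A_def incseq_def by (auto simp: frac_le intro: order_trans[OF frac_le])
    have "\<exists>n. x \<in> A n" if x: "x > 0" for x
    proof -
      obtain m where m: "1 / real (Suc m) < x" using nat_approx_posE[OF x] by metis
      obtain k where k: "x \<le> real k" using real_arch_simple by blast
      have "1 / real (Suc (max m k)) \<le> 1 / real (Suc m)" by (intro frac_le) auto
      then have "x \<in> A (max m k)" using m k by (auto simp: A_def)
      then show ?thesis by blast
    qed
    moreover have "A n \<subseteq> {0<..}" for n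
      by (auto simp: A_def intro: less_le_trans[rotated])
    ultimately show "(\<Union>n. A n) = {0<..}" by auto
  qed
  have sup: "(\<integral>\<^sup>+r. h r * indicator {0<..} r \<partial>lborel) = (SUP n. \<integral>\<^sup>+r. h r * indicator (A n) r \<partial>lborel)"
  proof -
    \<comment> \<open>Reading the integrals as values of the measure with density \<open>h\<close>
      makes continuity from below applicable.\<close>
    have "(SUP n. \<integral>\<^sup>+r. h r * indicator (A n) r \<partial>lborel) = (SUP n. emeasure (density lborel h) (A n))"
      by (simp add: emeasure_density A_def)
    also have "\<dots> = emeasure (density lborel h) {0<..}"
      using A by (subst SUP_emeasure_incseq) (auto simp: A_def)
    finally show ?thesis by (simp add: emeasure_density)
  qed
  show ?thesis
  proof (rule order_tendstoI)
    fix y assume "y < (\<integral>\<^sup>+r. h r * indicator {0<..} r \<partial>lborel)"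
    then obtain n where n: "y < (\<integral>\<^sup>+r. h r * indicator (A n) r \<partial>lborel)"
      unfolding sup less_SUP_iff by blast
    have "\<forall>\<^sub>F a in at_right 0. a < 1 / real (Suc n)"
      by (rule eventually_at_rightI[of 0 "1 / real (Suc n)"]) auto
    moreover have "\<forall>\<^sub>F b in at_top. real n \<le> b" by (rule eventually_ge_at_top)
    ultimately have "\<forall>\<^sub>F x in at_right 0 \<times>\<^sub>F at_top. fst x < 1 / real (Suc n) \<and> real n \<le> snd x"
      unfolding eventually_prod_filter by fastforce
    then show "\<forall>\<^sub>F x in at_right 0 \<times>\<^sub>F at_top. y < (case x of (a, b) \<Rightarrow> \<integral>\<^sup>+r. h r * indicator {a..b} r \<partial>lborel)"
    proof eventually_elim
      case (elim x)
      then have "(\<integral>\<^sup>+r. h r * indicator (A n) r \<partial>lborel) \<le> (\<integral>\<^sup>+r. h r * indicator {fst x..snd x} r \<partial>lborel)"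
        by (intro nn_integral_mono) (auto simp: A_def split: split_indicator)
      then show ?case using n by (auto simp: case_prod_unfold)
    qed
  next
    fix y assume y: "(\<integral>\<^sup>+r. h r * indicator {0<..} r \<partial>lborel) < y"
    have "\<forall>\<^sub>F a in at_right (0::real). 0 < a" by (rule eventually_at_right_less)
    then have "\<forall>\<^sub>F x in at_right (0::real) \<times>\<^sub>F at_top. 0 < fst x"
      by (rule eventually_compose_filterlim[OF _ filterlim_fst])
    then show "\<forall>\<^sub>F x in at_right 0 \<times>\<^sub>F at_top. (case x of (a, b) \<Rightarrow> \<integral>\<^sup>+r. h r * indicator {a..b} r \<partial>lborel) < y"
    proof eventually_elim
      case (elim x)
      then have "(\<integral>\<^sup>+r. h r * indicator {fst x..snd x} r \<partial>lborel) \<le> (\<integral>\<^sup>+r. h r * indicator {0<..} r \<partial>lborel)"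
        by (intro nn_integral_mono) (auto split: split_indicator)
      then show ?case using y by (auto simp: case_prod_unfold)
    qed
  qed
qed

text \<open>The point 1 merely separates the two endpoints, so that they bound a genuine interval
  inside the positive half line.\<close>

lemma eventually_0_lt_fst_lt_1_le_snd:
  "\<forall>\<^sub>F x in at_right (0::real) \<times>\<^sub>F at_top. 0 < fst x \<and> fst x < 1 \<and> (1::real) \<le> snd x"
proof -
  have "\<forall>\<^sub>F a in at_right (0::real). 0 < a \<and> a < 1"
    by (rule eventually_at_rightI[of 0 1]) auto
  from eventually_compose_filterlim[OF this filterlim_fst]
    eventually_compose_filterlim[OF eventually_ge_at_top[of "1::real"] filterlim_snd]
  show ?thesis by eventually_elim simp
qed

section \<open>Gamma densities\<close>

text \<open>The indicator cuts off the half line on which nothing is assumed about \<open>X\<close>,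
  so pointwise estimates of products with \<open>Z\<close> become trivial there.\<close>

definition gamma_density :: "real \<Rightarrow> real \<Rightarrow> real \<Rightarrow> real" where
  "gamma_density c p r =
     indicator {0<..} r * (c powr p * r powr (p - 1) * exp (- (c * r)) / Gamma p)"

lemma gamma_density_measurable [measurable]: "gamma_density c p \<in> borel_measurable borel"
  unfolding gamma_density_def by measurable

lemma gamma_density_nonneg: "p > 0 \<Longrightarrow> 0 \<le> gamma_density c p r"
  by (simp add: gamma_density_def)

lemma gamma_density_pos: "c > 0 \<Longrightarrow> p > 0 \<Longrightarrow> r > 0 \<Longrightarrow> 0 < gamma_density c p r"
  by (simp add: gamma_density_def)

lemma Gamma_real_neq_0: "p > 0 \<Longrightarrow> Gamma (p::real) \<noteq> 0"
  using Gamma_real_pos by (metis less_irrefl)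

text \<open>Euler's integral for \<open>Gamma p\<close> after the substitution t = c r.\<close>

lemma nn_integral_gamma_density:
  assumes "c > 0" "p > 0"
  shows "(\<integral>\<^sup>+r. ennreal (gamma_density c p r) \<partial>lborel) = 1"
proof -
  \<comment> \<open>The shape \<open>0 + c * r\<close> is the one produced by the affine
    substitution. Euler's integrand includes the point 0 and the density does not; they agree there
    because \<open>0 powr (p - 1)\<close> is 0.\<close>
  have eq: "ennreal c * ennreal (indicator {0..} (0 + c * r) * (0 + c * r) powr (p - 1) / exp (0 + c * r))
      = ennreal (Gamma p) * ennreal (gamma_density c p r)" for r
  proof (cases "r > 0")
    case True
    have "c * (c * r) powr (p - 1) = c powr p * r powr (p - 1)"
      using assms True by (simp add: powr_mult powr_diff)
    then show ?thesis
      using assms True Gamma_real_neq_0[of p]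
      by (simp add: gamma_density_def exp_minus field_simps zero_le_mult_iff flip: ennreal_mult')
  next
    case False
    then show ?thesis
      using assms by (cases "r = 0") (auto simp: gamma_density_def indicator_def zero_le_mult_iff)
  qed
  have "ennreal (Gamma p) = (\<integral>\<^sup>+t. ennreal (indicator {0..} t * t powr (p - 1) / exp t) \<partial>lborel)"
    using assms by (rule_tac Gamma_conv_nn_integral_real)
  also have "\<dots> = (\<integral>\<^sup>+r. ennreal (Gamma p) * ennreal (gamma_density c p r) \<partial>lborel)"
    using assms by (subst nn_integral_real_affine[where c = c and t = 0])
      (simp_all add: eq[simplified] flip: nn_integral_cmult)
  also have "\<dots> = ennreal (Gamma p) * (\<integral>\<^sup>+r. ennreal (gamma_density c p r) \<partial>lborel)"
    by (simp add: nn_integral_cmult)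
  finally have "ennreal (Gamma p) * 1 = ennreal (Gamma p) * (\<integral>\<^sup>+r. ennreal (gamma_density c p r) \<partial>lborel)"
    by simp
  then show ?thesis
    using Gamma_real_pos[OF \<open>p > 0\<close>] by (subst (asm) ennreal_mult_cancel_left) auto
qed

lemma nn_integral_gamma_density_mult:
  assumes "c > 0" "p > 0" "k \<ge> 0"
  shows "(\<integral>\<^sup>+r. ennreal (gamma_density c p r * k) \<partial>lborel) = ennreal k"
  using assms gamma_density_nonneg[OF assms(2)]
  by (simp add: ennreal_mult nn_integral_multc nn_integral_gamma_density)

text \<open>The quotient of densities increases in \<open>r\<close>, which yields the single
  crossing, and it is small on bounded intervals for large shapes, which yields the limit.\<close>

lemma gamma_density_ratio:
  assumes "c > 0" "p > 0" "q > 0"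
  shows "gamma_density c (p + q) r = (c * r) powr q * Gamma p / Gamma (p + q) * gamma_density c p r"
proof (cases "r > 0")
  case True
  have "r powr (p + q - 1) = r powr q * r powr (p - 1)"
    by (simp flip: powr_add add: algebra_simps)
  then show ?thesis
    using assms True Gamma_real_neq_0[of p] by (simp add: gamma_density_def powr_mult powr_add)
qed (simp add: gamma_density_def)

text \<open>The quotient of the two densities is a constant times
  \<open>(c * r) powr (q - p)\<close>; it increases strictly from 0 to infinity, so it passes 1
  exactly once.\<close>

lemma gamma_density_single_crossing:
  assumes "c > 0" "0 < p" "p < q"
  obtains r0 where "r0 > 0"
    and "\<And>r. 0 < r \<Longrightarrow> r < r0 \<Longrightarrow> gamma_density c q r < gamma_density c p r"
    and "\<And>r. r0 < r \<Longrightarrow> gamma_density c p r < gamma_density c q r"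
proof -
  define K where "K = Gamma q / Gamma p"
  define s where "s = q - p"
  \<comment> \<open>The solution of \<open>(c * r) powr s = K\<close>, where the quotient of the
    densities equals 1.\<close>
  define r0 where "r0 = K powr (1 / s) / c"
  have "K > 0" "s > 0" using assms by (simp_all add: K_def s_def Gamma_real_pos)
  then have "r0 > 0" and K: "(c * r0) powr s = K"
    using assms by (simp_all add: r0_def powr_powr)
  have ratio: "gamma_density c q r = (c * r) powr s / K * gamma_density c p r" for r
    using gamma_density_ratio[of c p s r] assms by (simp add: K_def s_def)
  show thesis
  proof (rule that[OF \<open>r0 > 0\<close>])
    show "gamma_density c q r < gamma_density c p r" if "0 < r" "r < r0" for r
    proof -
      have "(c * r) powr s < (c * r0) powr s"
        using assms that \<open>s > 0\<close> by (intro powr_less_mono2) auto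
      then have "(c * r) powr s / K < 1" using K \<open>K > 0\<close> by simp
      then show ?thesis
        using gamma_density_pos[of c p r] assms that
          mult_strict_right_mono[of "(c * r) powr s / K" 1 "gamma_density c p r"]
        unfolding ratio by simp
    qed
    show "gamma_density c p r < gamma_density c q r" if "r0 < r" for r
    proof -
      have "(c * r0) powr s < (c * r) powr s"
        using assms that \<open>r0 > 0\<close> \<open>s > 0\<close> by (intro powr_less_mono2) auto
      then have "1 < (c * r) powr s / K" using K \<open>K > 0\<close> by simp
      then show ?thesis
        using gamma_density_pos[of c p r] assms that \<open>r0 > 0\<close>
          mult_strict_right_mono[of 1 "(c * r) powr s / K" "gamma_density c p r"]
        unfolding ratio by simp
    qed
  qed
qed

section \<open>The decaying function and its exponential rescaling\<close>

text \<open>Differentiability is listed separately because \<open>deriv\<close> is total: its sign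
  is informative only where the derivative exists.\<close>

locale exp_decay =
  fixes c :: real and X :: "real \<Rightarrow> real"
  assumes c_pos: "c > 0"
    and X_nonneg: "\<And>t. t > 0 \<Longrightarrow> X t \<ge> 0"
    and X_differentiable: "\<And>t. t > 0 \<Longrightarrow> X differentiable (at t)"
    and deriv_X: "\<And>t. t > 0 \<Longrightarrow> deriv X t \<le> 0"
    and deriv_exp_X: "\<And>t. t > 0 \<Longrightarrow> deriv (\<lambda>s. exp (c * s) * X s) t \<le> 0"
begin

definition Z :: "real \<Rightarrow> real" where "Z t = exp (c * t) * X t"

lemma X_eq: "X t = exp (- (c * t)) * Z t"
  by (simp add: Z_def exp_minus)

lemma X_has_derivative: "t > 0 \<Longrightarrow> (X has_real_derivative deriv X t) (at t)"
  using X_differentiable DERIV_deriv_iff_real_differentiable by blast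

lemma X_continuous: "continuous_on {0<..} X"
  using X_has_derivative by (auto intro!: continuous_at_imp_continuous_on intro: DERIV_isCont)

lemma Z_continuous: "continuous_on {0<..} Z"
  unfolding Z_def by (intro continuous_intros X_continuous)

lemma Z_nonneg: "t > 0 \<Longrightarrow> 0 \<le> Z t"
  by (simp add: Z_def X_nonneg)

lemma Z_antimono:
  assumes "0 < s" "s \<le> t"
  shows "Z t \<le> Z s"
proof (rule DERIV_nonpos_imp_nonincreasing[OF \<open>s \<le> t\<close>])
  fix x assume "s \<le> x"
  then have "x > 0" using assms by simp
  then have "(Z has_real_derivative c * exp (c * x) * X x + exp (c * x) * deriv X x) (at x)"
    unfolding Z_def by (auto intro!: derivative_eq_intros X_has_derivative)
  then have "(Z has_real_derivative deriv Z x) (at x)"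
    using DERIV_imp_deriv by metis
  moreover have "Z = (\<lambda>s. exp (c * s) * X s)" by (simp add: fun_eq_iff Z_def)
  ultimately show "\<exists>y. DERIV Z x :> y \<and> y \<le> 0"
    using deriv_exp_X[OF \<open>x > 0\<close>] by auto
qed

lemma X_antimono: "0 < s \<Longrightarrow> s \<le> t \<Longrightarrow> X t \<le> X s"
  by (rule DERIV_nonpos_imp_nonincreasing[of s t X])
    (meson X_has_derivative deriv_X less_le_trans)+

lemma indicator_Z_measurable [measurable]:
  "(\<lambda>r. indicator {0<..} r * Z r) \<in> borel_measurable borel"
  using borel_measurable_continuous_on_indicator[OF _ Z_continuous] by simp

lemma gamma_density_Z_measurable [measurable]:
  "(\<lambda>r. gamma_density c p r * Z r) \<in> borel_measurable borel"
proof -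
  have "(\<lambda>r. gamma_density c p r * Z r) = (\<lambda>r. gamma_density c p r * (indicator {0<..} r * Z r))"
    by (auto simp: gamma_density_def fun_eq_iff indicator_def)
  then show ?thesis by simp
qed

section \<open>Gamma means of \<open>Z\<close>: monotonicity in the shape and the equality
  case\<close>

text \<open>Shape 0 has no density: the gamma laws concentrate at 0 as the shape tends to 0. The
  value there is the limit of \<open>Z\<close> at 0, which is its supremum since \<open>Z\<close> is
  nonincreasing.\<close>

definition W :: "real \<Rightarrow> ennreal" where
  "W p = (if p = 0 then SUP t\<in>{0<..}. ennreal (Z t)
          else \<integral>\<^sup>+r. ennreal (gamma_density c p r * Z r) \<partial>lborel)"

lemma W_const:
  assumes "\<And>t. t > 0 \<Longrightarrow> Z t = k" "p \<ge> 0"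
  shows "W p = ennreal k"
proof (cases "p = 0")
  case True
  have "W p = (SUP t\<in>{0::real<..}. ennreal k)"
    using assms by (auto simp: W_def True intro!: SUP_cong)
  then show ?thesis by simp
next
  case False
  have "k \<ge> 0" using Z_nonneg[of 1] assms by simp
  have "W p = (\<integral>\<^sup>+r. ennreal (gamma_density c p r * k) \<partial>lborel)"
    using assms False by (auto simp: W_def gamma_density_def indicator_def intro!: nn_integral_cong)
  then show ?thesis
    using nn_integral_gamma_density_mult[OF c_pos _ \<open>k \<ge> 0\<close>, of p] assms False by simp
qed

text \<open>A set of full measure meets every interval, so it has points on both sides of
  \<open>t\<close>; monotonicity squeezes \<open>Z t\<close> between the values at such
  points.\<close>

lemma Z_const_if_AE:
  assumes "AE r in lborel. r > 0 \<longrightarrow> Z r = k" "t > 0"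
  shows "Z t = k"
proof (rule antisym)
  obtain x where "0 < x" "x < t" "Z x = k"
    using AE_lborel_interval_ex[OF assms] by auto
  then show "Z t \<le> k" using Z_antimono[of x t] by simp
  obtain y where "t < y" "Z y = k"
    using AE_lborel_interval_ex[OF assms(1), of t "t + 1"] assms(2) by auto
  then show "k \<le> Z t" using Z_antimono[of t y] assms(2) by simp
qed

text \<open>\<open>W 0\<close> bounds \<open>Z\<close> everywhere and the density has mass 1. As the
  density is positive on the half line, equality of finite values forces \<open>Z\<close> to equal
  this bound almost everywhere.\<close>

lemma
  assumes "p > 0"
  shows W_le_W_0: "W p \<le> W 0"
    and W_eq_W_0_imp_Z_const: "W p = W 0 \<Longrightarrow> W 0 < \<infinity> \<Longrightarrow> \<exists>k. \<forall>t>0. Z t = k"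
proof -
  have le: "ennreal (gamma_density c p r * Z r) \<le> ennreal (gamma_density c p r) * W 0" for r
  proof (cases "r > 0")
    case True
    then have "ennreal (Z r) \<le> W 0" by (auto simp: W_def intro: SUP_upper)
    then show ?thesis
      using True assms Z_nonneg gamma_density_nonneg by (simp add: ennreal_mult mult_left_mono)
  qed (simp add: gamma_density_def)
  have int: "(\<integral>\<^sup>+r. ennreal (gamma_density c p r) * W 0 \<partial>lborel) = W 0"
    using assms by (simp add: nn_integral_multc nn_integral_gamma_density c_pos)
  have W: "W p = (\<integral>\<^sup>+r. ennreal (gamma_density c p r * Z r) \<partial>lborel)"
    using assms by (simp add: W_def)
  show "W p \<le> W 0"
    unfolding W by (subst int[symmetric]) (intro nn_integral_mono le)
  assume eq: "W p = W 0" and fin: "W 0 < \<infinity>"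
  then obtain k where k: "W 0 = ennreal k" "k \<ge> 0" by (cases "W 0") auto
  have "AE r in lborel. ennreal (gamma_density c p r * Z r) = ennreal (gamma_density c p r) * W 0"
    using eq fin by (intro nn_integral_eq_imp_AE_eq le) (auto simp: int W)
  then have "AE r in lborel. r > 0 \<longrightarrow> Z r = k"
  proof eventually_elim
    case (elim r)
    then show ?case
      using gamma_density_pos[OF c_pos assms, of r] Z_nonneg[of r] k
      by (auto simp flip: ennreal_mult)
  qed
  then show "\<exists>k. \<forall>t>0. Z t = k" using Z_const_if_AE by blast
qed

text \<open>Centring \<open>Z\<close> at its value at the crossing point changes both means by the
  same finite amount, because both densities have mass 1; the amount cancels at the end. After
  centring, the comparison holds pointwise.\<close>

lemma
  assumes "0 < p" "p < q"
  shows W_antimono_pos: "W q \<le> W p"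
    and W_eq_imp_Z_const_pos: "W q = W p \<Longrightarrow> W p < \<infinity> \<Longrightarrow> \<exists>k. \<forall>t>0. Z t = k"
proof -
  define g where "g = gamma_density c"
  obtain r0 where "r0 > 0"
    and lt: "\<And>r. 0 < r \<Longrightarrow> r < r0 \<Longrightarrow> g q r < g p r"
    and gt: "\<And>r. r0 < r \<Longrightarrow> g p r < g q r"
    using gamma_density_single_crossing[OF c_pos assms] unfolding g_def by metis
  define k where "k = Z r0"
  have "k \<ge> 0" using Z_nonneg \<open>r0 > 0\<close> by (simp add: k_def)
  have g_nonneg: "0 \<le> g p r" "0 \<le> g q r" for r
    using assms by (simp_all add: g_def gamma_density_nonneg)
  have [measurable]: "g s \<in> borel_measurable borel" "(\<lambda>r. g s r * Z r) \<in> borel_measurable borel" for s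
    unfolding g_def by measurable
  have g_zero: "g s r = 0" if "r \<le> 0" for r s
    using that by (simp add: g_def gamma_density_def)
  \<comment> \<open>$(g_q - g_p)(Z - Z(r_0)) \le 0$, written without subtraction because the integrals of $g_q Z$
    and $g_p Z$ may be infinite.\<close>
  have le: "g q r * Z r + g p r * k \<le> g p r * Z r + g q r * k" for r
  proof (cases "r > 0")
    case True
    have "(g q r - g p r) * (Z r - k) \<le> 0"
      using True lt[of r] gt[of r] Z_antimono[of r r0] Z_antimono[of r0 r] \<open>r0 > 0\<close>
      by (cases r r0 rule: linorder_cases) (auto simp: k_def mult_le_0_iff)
    then show ?thesis by (simp add: algebra_simps)
  qed (simp add: g_zero)
  have int: "(\<integral>\<^sup>+r. ennreal (g s r * Z r + g s' r * k) \<partial>lborel) = W s + ennreal k"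
    if "s \<in> {p, q}" "s' \<in> {p, q}" for s s'
  proof -
    have "s > 0" "s' > 0" using that assms by auto
    have "0 \<le> g s r * Z r" for r
      using \<open>s > 0\<close> Z_nonneg[of r]
      by (cases "r > 0") (simp_all add: g_zero g_def[symmetric], simp add: g_def gamma_density_nonneg)
    then have "(\<integral>\<^sup>+r. ennreal (g s r * Z r + g s' r * k) \<partial>lborel)
      = (\<integral>\<^sup>+r. ennreal (g s r * Z r) + ennreal (g s' r * k) \<partial>lborel)"
      using \<open>k \<ge> 0\<close> \<open>s' > 0\<close> by (intro nn_integral_cong ennreal_plus) (auto simp: g_def gamma_density_nonneg)
    also have "\<dots> = W s + ennreal k"
      using nn_integral_gamma_density_mult[OF c_pos \<open>s' > 0\<close> \<open>k \<ge> 0\<close>] \<open>s > 0\<close>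
      by (subst nn_integral_add) (auto simp: W_def g_def)
    finally show ?thesis .
  qed
  have "W q + ennreal k \<le> W p + ennreal k"
    using nn_integral_mono[of lborel "\<lambda>r. ennreal (g q r * Z r + g p r * k)"
        "\<lambda>r. ennreal (g p r * Z r + g q r * k)"] le
    by (simp add: int ennreal_leI)
  then show "W q \<le> W p"
    by (simp add: ennreal_add_left_cancel_le add.commute[of _ "ennreal k"])
  assume eq: "W q = W p" and fin: "W p < \<infinity>"
  have "AE r in lborel. ennreal (g q r * Z r + g p r * k) = ennreal (g p r * Z r + g q r * k)"
    using eq fin le by (intro nn_integral_eq_imp_AE_eq) (auto simp: int ennreal_leI)
  then have "AE r in lborel. r > 0 \<longrightarrow> Z r = k"
    \<comment> \<open>The crossing point is left out: only away from it are the two densities known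
      to differ, so that the vanishing product forces \<open>Z r = k\<close>.\<close>
    using AE_lborel_singleton[of r0]
  proof eventually_elim
    case (elim r)
    show ?case
    proof
      assume "r > 0"
      have "g q r * Z r + g p r * k = g p r * Z r + g q r * k"
        using elim(1) \<open>k \<ge> 0\<close> g_nonneg[of r] Z_nonneg[OF \<open>r > 0\<close>] by (subst (asm) ennreal_inj) auto
      then have "(g q r - g p r) * (Z r - k) = 0" by (simp add: algebra_simps)
      moreover have "g q r \<noteq> g p r"
        using lt[of r] gt[of r] elim(2) \<open>r > 0\<close> by (cases r r0 rule: linorder_cases) auto
      ultimately show "Z r = k" by simp
    qed
  qed
  then show "\<exists>k. \<forall>t>0. Z t = k" using Z_const_if_AE by blast
qed

lemma W_antimono: "0 \<le> p \<Longrightarrow> p \<le> q \<Longrightarrow> W q \<le> W p"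
  using W_le_W_0[of q] W_antimono_pos[of p q] by (cases "p = q"; cases "p = 0") auto

lemma W_eq_imp_Z_const:
  "0 \<le> p \<Longrightarrow> p < q \<Longrightarrow> W q = W p \<Longrightarrow> W p < \<infinity> \<Longrightarrow> \<exists>k. \<forall>t>0. Z t = k"
  using W_eq_W_0_imp_Z_const[of q] W_eq_imp_Z_const_pos[of p q] by (cases "p = 0") auto

section \<open>Evaluation of the Stieltjes integrals as gamma means\<close>

lemma has_rs_integral_powr_X:
  assumes "0 < a" "a \<le> b"
  shows "has_rs_integral (\<lambda>r. r powr p) X a b
           (b powr p * X b - a powr p * X a - integral {a..b} (\<lambda>r. p * r powr (p - 1) * X r))"
  using assms X_has_derivative deriv_X
  by (intro has_rs_integral_by_parts[where g' = "deriv X"])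
    (auto intro!: has_real_derivative_powr continuous_intros)

text \<open>\<open>Lim\<close> is a definite description, so a limit has to be exhibited before it
  has a usable value. The expression under the limit is the negated by-parts formula, matching the
  minus sign in \<open>Y\<close>.\<close>

lemma Y_eqI:
  assumes "((\<lambda>(a, b). ereal (a powr p * X a - b powr p * X b +
      integral {a..b} (\<lambda>r. p * r powr (p - 1) * X r))) \<longlongrightarrow> y) (at_right 0 \<times>\<^sub>F at_top)"
    (is "(?T \<longlongrightarrow> y) ?F")
  shows "Y X p 0 = y"
proof -
  from eventually_0_lt_fst_lt_1_le_snd have "\<forall>\<^sub>F x in ?F. - ?T x = (case x of (a, b) \<Rightarrow> ereal (rs_integral (\<lambda>r. r powr p) X a b))"
  proof eventually_elim
    case (elim x)
    then show ?case
      using rs_integral_eqI[OF has_rs_integral_powr_X[of "fst x" "snd x" p]]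
      by (auto simp: case_prod_unfold)
  qed
  then have "((\<lambda>(a, b). ereal (rs_integral (\<lambda>r. r powr p) X a b)) \<longlongrightarrow> - y) ?F"
    using tendsto_uminus_ereal[OF assms] by (rule Lim_transform_eventually[rotated])
  then have "Lim ?F (\<lambda>(a, b). ereal (rs_integral (\<lambda>r. r powr p) X a b)) = - y"
    by (intro tendsto_Lim) (auto simp: prod_filter_eq_bot)
  then show ?thesis by (simp add: Y_def improper_rs_integral_def)
qed

text \<open>For \<open>b\<close> at least 1, \<open>Z b\<close> is at most \<open>Z 1\<close>, so
  \<open>X\<close> decays at least like exp(-cb), faster than any power grows. This removes the
  boundary term at infinity for every exponent.\<close>

lemma powr_X_tendsto_0: "((\<lambda>b. b powr p * X b) \<longlongrightarrow> 0) at_top"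
proof (rule tendsto_sandwich[OF _ _ tendsto_const])
  show "\<forall>\<^sub>F b in at_top. 0 \<le> b powr p * X b"
    using eventually_gt_at_top[of 0] by eventually_elim (simp add: X_nonneg)
  show "\<forall>\<^sub>F b in at_top. b powr p * X b \<le> b powr p * exp (- (c * b)) * Z 1"
    using eventually_ge_at_top[of 1]
    by eventually_elim (simp add: X_eq mult.assoc mult_left_mono Z_antimono)
  have "((\<lambda>b. b powr p * exp (- (c * b))) \<longlongrightarrow> 0) at_top"
    using c_pos by real_asymp
  then show "((\<lambda>b. b powr p * exp (- (c * b)) * Z 1) \<longlongrightarrow> 0) at_top"
    by (rule tendsto_mult_left_zero)
qed

lemma Z_tendsto_SUP: "((\<lambda>t. ennreal (Z t)) \<longlongrightarrow> (SUP t\<in>{0<..}. ennreal (Z t))) (at_right 0)"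
proof (rule order_tendstoI)
  fix y assume "y < (SUP t\<in>{0<..}. ennreal (Z t))"
  then obtain s where "s > 0" "y < ennreal (Z s)" by (auto simp: less_SUP_iff)
  moreover have "\<forall>\<^sub>F t in at_right 0. t \<in> {0<..<s}"
    using \<open>s > 0\<close> by (rule eventually_at_right_real)
  ultimately show "\<forall>\<^sub>F t in at_right 0. y < ennreal (Z t)"
  proof (elim eventually_mono)
    fix t assume "y < ennreal (Z s)" "t \<in> {0<..<s}"
    moreover from this have "ennreal (Z s) \<le> ennreal (Z t)" by (intro ennreal_leI Z_antimono) auto
    ultimately show "y < ennreal (Z t)" by (rule_tac less_le_trans)
  qed
next
  fix y assume *: "(SUP t\<in>{0<..}. ennreal (Z t)) < y"
  have "\<forall>\<^sub>F t in at_right (0::real). 0 < t" by (rule eventually_at_right_less)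
  then show "\<forall>\<^sub>F t in at_right 0. ennreal (Z t) < y"
    by (rule eventually_mono) (intro le_less_trans[OF SUP_upper *], simp)
qed

text \<open>For exponent 0 the Stieltjes sums telescope to the drop of \<open>X\<close>.
  \<open>X\<close> vanishes at infinity, and near 0 it has the same limit as \<open>Z\<close>
  because exp(-ca) tends to 1.\<close>

lemma Y_zero: "Y X 0 0 = enn2ereal (W 0)"
proof (rule Y_eqI)
  have "((\<lambda>a. enn2ereal (ennreal (Z a))) \<longlongrightarrow> enn2ereal (W 0)) (at_right 0)"
    unfolding W_def using Z_tendsto_SUP by (simp add: tendsto_enn2erealI)
  moreover have "((\<lambda>a. ereal (exp (- (c * a)))) \<longlongrightarrow> ereal (exp (- (c * 0)))) (at_right 0)"
    by (intro tendsto_intros)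
  ultimately have "((\<lambda>a. ereal (exp (- (c * a))) * enn2ereal (ennreal (Z a))) \<longlongrightarrow>
      ereal (exp (- (c * 0))) * enn2ereal (W 0)) (at_right 0)"
    by (intro tendsto_mult_ereal) auto
  then have "((\<lambda>a. ereal (exp (- (c * a))) * enn2ereal (ennreal (Z a))) \<longlongrightarrow> enn2ereal (W 0)) (at_right 0)"
    by (simp flip: one_ereal_def)
  moreover have "\<forall>\<^sub>F a in at_right (0::real). 0 < a" by (rule eventually_at_right_less)
  then have "\<forall>\<^sub>F a in at_right 0. ereal (exp (- (c * a))) * enn2ereal (ennreal (Z a)) = ereal (X a)"
    by eventually_elim (simp add: Z_nonneg X_eq)
  ultimately have "((\<lambda>a. ereal (X a)) \<longlongrightarrow> enn2ereal (W 0)) (at_right 0)"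
    by (rule Lim_transform_eventually)
  then have 1: "((\<lambda>x. ereal (X (fst x))) \<longlongrightarrow> enn2ereal (W 0)) (at_right 0 \<times>\<^sub>F at_top)"
    by (rule filterlim_compose[OF _ filterlim_fst])
  have "((\<lambda>b. - (b powr 0 * X b)) \<longlongrightarrow> - 0) at_top"
    by (intro tendsto_minus powr_X_tendsto_0)
  moreover have "\<forall>\<^sub>F b in at_top. - (b powr 0 * X b) = - X b"
    using eventually_gt_at_top[of 0] by eventually_elim simp
  ultimately have "((\<lambda>b. - X b) \<longlongrightarrow> - 0) at_top" by (rule Lim_transform_eventually)
  then have "((\<lambda>x. - X (snd x)) \<longlongrightarrow> - 0) (at_right 0 \<times>\<^sub>F at_top)"
    by (rule filterlim_compose[OF _ filterlim_snd])
  then have 2: "((\<lambda>x. ereal (- X (snd x))) \<longlongrightarrow> 0) (at_right 0 \<times>\<^sub>F at_top)"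
    by (simp add: zero_ereal_def)
  \<comment> \<open>The second limit is finite, so the sum is safe even when the first is
    infinite.\<close>
  have "((\<lambda>x. ereal (X (fst x)) + ereal (- X (snd x))) \<longlongrightarrow> enn2ereal (W 0) + 0) (at_right 0 \<times>\<^sub>F at_top)"
    using 1 2 by (intro tendsto_add_ereal_general1) auto
  moreover from eventually_0_lt_fst_lt_1_le_snd have "\<forall>\<^sub>F x in at_right 0 \<times>\<^sub>F at_top. ereal (X (fst x)) + ereal (- X (snd x)) =
      (case x of (a, b) \<Rightarrow> ereal (a powr 0 * X a - b powr 0 * X b +
         integral {a..b} (\<lambda>r. 0 * r powr (0 - 1) * X r)))"
    by eventually_elim (auto simp: case_prod_unfold)
  ultimately show "((\<lambda>(a, b). ereal (a powr 0 * X a - b powr 0 * X b +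
      integral {a..b} (\<lambda>r. 0 * r powr (0 - 1) * X r))) \<longlongrightarrow> enn2ereal (W 0)) (at_right 0 \<times>\<^sub>F at_top)"
    using Lim_transform_eventually by fastforce
qed

text \<open>The boundary term at 0 need not vanish: for X(t) = exp(-ct) t^(-p) it tends to 1. It is
  therefore squeezed instead of being sent to 0: dropped in the lower bound, absorbed into the
  integral over (0, a) in the upper one.\<close>

lemma Y_pos:
  assumes "p > 0"
  shows "Y X p 0 = enn2ereal (\<integral>\<^sup>+r. ennreal (p * r powr (p - 1) * X r) * indicator {0<..} r \<partial>lborel)"
    (is "_ = enn2ereal ?I")
proof (rule Y_eqI)
  define h where "h = (\<lambda>r. p * r powr (p - 1) * X r)"
  define h' where "h' = (\<lambda>r. ennreal (h r) * indicator {0<..} r)"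
  have [measurable]: "h' \<in> borel_measurable borel"
  proof -
    have "continuous_on {0<..} h"
      unfolding h_def by (intro continuous_intros X_continuous) auto
    then have "(\<lambda>r. indicator {0<..} r * h r) \<in> borel_measurable borel"
      using borel_measurable_continuous_on_indicator[of "{0<..}" h] by simp
    then have "(\<lambda>r. ennreal (indicator {0<..} r * h r)) \<in> borel_measurable borel" by measurable
    also have "(\<lambda>r. ennreal (indicator {0<..} r * h r)) = h'"
      by (auto simp: h'_def fun_eq_iff indicator_def)
    finally show ?thesis .
  qed
  have h_nonneg: "0 \<le> h r" if "r > 0" for r using that assms X_nonneg by (simp add: h_def)
  have h_integrable: "h integrable_on {a..b}" if "0 < a" for a b
    unfolding h_def using that
    by (intro integrable_continuous_interval continuous_intros continuous_on_subset[OF X_continuous]) auto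
  have int_nonneg: "0 \<le> integral {a..b} h" if "0 < a" for a b
    using that by (intro integral_nonneg h_integrable h_nonneg) auto
  have h_int: "(\<integral>\<^sup>+r. h' r * indicator {a..b} r \<partial>lborel) = ennreal (integral {a..b} h)"
    if "0 < a" for a b
  proof -
    have "(\<integral>\<^sup>+r. ennreal (h r) * indicator {a..b} r \<partial>lborel) = ennreal (integral {a..b} h)"
      using that by (intro nn_integral_has_integral_lebesgue' h_nonneg integrable_integral h_integrable) auto
    moreover have "h' r * indicator {a..b} r = ennreal (h r) * indicator {a..b} r" for r
      using that by (auto simp: h'_def indicator_def)
    ultimately show ?thesis by simp
  qed
  \<comment> \<open>$a^p X(a) = X(a) \int_0^a p r^{p-1}\,dr$ and $X$ is nonincreasing, so the boundary term at
    $a$ never overshoots the missing part of the integral, whether finite or not.\<close>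
  have boundary: "ennreal (a powr p * X a) \<le> (\<integral>\<^sup>+r. h' r * indicator {0..<a} r \<partial>lborel)" if "0 < a" for a
  proof -
    have "((\<lambda>r. r powr (p - 1)) has_integral a powr p / p) {0..a}"
      using has_integral_powr_from_0[of "p - 1" a] assms that by simp
    then have "((\<lambda>r. p * r powr (p - 1) * X a) has_integral p * (a powr p / p) * X a) {0..a}"
      by (intro has_integral_mult_left has_integral_mult_right)
    then have "ennreal (a powr p * X a) = (\<integral>\<^sup>+r. ennreal (p * r powr (p - 1) * X a) * indicator {0..a} r \<partial>lborel)"
      using assms that X_nonneg[of a] by (subst nn_integral_has_integral_lebesgue') auto
    also have "\<dots> \<le> (\<integral>\<^sup>+r. h' r * indicator {0..<a} r \<partial>lborel)"
      using AE_lborel_singleton[of a] AE_lborel_singleton[of "0::real"]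
    proof (intro nn_integral_mono_AE, eventually_elim)
      case (elim r)
      then show ?case
        using assms X_antimono[of r a]
        by (auto simp: h'_def h_def indicator_def intro!: ennreal_leI mult_left_mono)
    qed
    finally show ?thesis .
  qed
  define T where "T = (\<lambda>(a, b). ereal (a powr p * X a - b powr p * X b + integral {a..b} h))"
  have I: "?I = (\<integral>\<^sup>+r. h' r * indicator {0<..} r \<partial>lborel)" "?I = integral\<^sup>N lborel h'"
    by (auto simp: h'_def h_def indicator_def intro!: nn_integral_cong)
  have "(T \<longlongrightarrow> enn2ereal ?I) (at_right 0 \<times>\<^sub>F at_top)"
  proof -
    let ?L = "\<lambda>x. enn2ereal (\<integral>\<^sup>+r. h' r * indicator {fst x..snd x} r \<partial>lborel) + ereal (- (snd x powr p * X (snd x)))"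
    have lower: "\<forall>\<^sub>F x in at_right 0 \<times>\<^sub>F at_top. ?L x \<le> T x"
      using eventually_0_lt_fst_lt_1_le_snd
    proof eventually_elim
      case (elim x)
      then show ?case
        using X_nonneg[of "fst x"] int_nonneg[of "fst x" "snd x"] by (simp add: T_def case_prod_unfold h_int)
    qed
    have upper: "\<forall>\<^sub>F x in at_right 0 \<times>\<^sub>F at_top. T x \<le> enn2ereal ?I"
      using eventually_0_lt_fst_lt_1_le_snd
    proof eventually_elim
      case (elim x)
      define a b where "a = fst x" and "b = snd x"
      have ab: "0 < a" "a \<le> b" using elim by (auto simp: a_def b_def)
      note int = int_nonneg[OF ab(1), of b]
      have "ennreal (a powr p * X a + integral {a..b} h)
          \<le> (\<integral>\<^sup>+r. h' r * indicator {0..<a} r \<partial>lborel) + (\<integral>\<^sup>+r. h' r * indicator {a..b} r \<partial>lborel)"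
        using boundary[OF ab(1)] int X_nonneg[OF ab(1)] by (simp add: h_int ab(1) add_mono)
      also have "\<dots> = (\<integral>\<^sup>+r. h' r * indicator {0..<a} r + h' r * indicator {a..b} r \<partial>lborel)"
        by (subst nn_integral_add) auto
      \<comment> \<open>The left piece is half-open, so the point \<open>a\<close> is counted only
        once and the two integrands add up to at most \<open>h'\<close>.\<close>
      also have "\<dots> \<le> ?I"
        unfolding I(2) by (intro nn_integral_mono) (auto simp: indicator_def)
      finally have "enn2ereal (ennreal (a powr p * X a + integral {a..b} h)) \<le> enn2ereal ?I"
        by (simp add: less_eq_ennreal.rep_eq)
      moreover have "enn2ereal (ennreal (a powr p * X a + integral {a..b} h))
          = ereal (a powr p * X a + integral {a..b} h)"
        using int X_nonneg[OF ab(1)] by (intro enn2ereal_ennreal) simp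
      moreover have "T x \<le> ereal (a powr p * X a + integral {a..b} h)"
        using ab X_nonneg[of b] by (simp add: T_def case_prod_unfold a_def b_def)
      ultimately show ?case by (metis order_trans)
    qed
    have "((\<lambda>x. \<integral>\<^sup>+r. h' r * indicator {fst x..snd x} r \<partial>lborel) \<longlongrightarrow> ?I) (at_right 0 \<times>\<^sub>F at_top)"
      unfolding I(1) using tendsto_nn_integral_interval[of h'] by (simp add: case_prod_unfold)
    then have "((\<lambda>x. enn2ereal (\<integral>\<^sup>+r. h' r * indicator {fst x..snd x} r \<partial>lborel)) \<longlongrightarrow> enn2ereal ?I)
        (at_right 0 \<times>\<^sub>F at_top)"
      by (rule tendsto_enn2erealI)
    moreover have "((\<lambda>x. snd x powr p * X (snd x)) \<longlongrightarrow> 0) (at_right (0::real) \<times>\<^sub>F at_top)"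
      by (rule filterlim_compose[OF powr_X_tendsto_0 filterlim_snd])
    from tendsto_minus[OF this] have "((\<lambda>x. ereal (- (snd x powr p * X (snd x)))) \<longlongrightarrow> 0) (at_right (0::real) \<times>\<^sub>F at_top)"
      by (simp add: zero_ereal_def)
    ultimately have "(?L \<longlongrightarrow> enn2ereal ?I + 0) (at_right 0 \<times>\<^sub>F at_top)"
      by (intro tendsto_add_ereal_general1) auto
    then have "(?L \<longlongrightarrow> enn2ereal ?I) (at_right 0 \<times>\<^sub>F at_top)" by simp
    then show ?thesis by (rule tendsto_sandwich[OF lower upper _ tendsto_const])
  qed
  then show "((\<lambda>(a, b). ereal (a powr p * X a - b powr p * X b +
      integral {a..b} (\<lambda>r. p * r powr (p - 1) * X r))) \<longlongrightarrow> enn2ereal ?I) (at_right 0 \<times>\<^sub>F at_top)"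
    by (simp add: T_def h_def)
qed

text \<open>The factor \<open>p\<close> from differentiating the power cancels against Gamma(p+1) =
  p Gamma(p); this is why the normalisation by \<open>Gamma (p + 1)\<close> leads to the density of
  shape \<open>p\<close>.\<close>

lemma normalized_Y_eq_W:
  assumes "p \<ge> 0"
  shows "ereal (c powr p) * Y X p 0 / ereal (Gamma (p + 1)) = enn2ereal (W p)"
proof (cases "p = 0")
  case True
  then show ?thesis using c_pos by (simp add: Y_zero Gamma_plus1 divide_ereal_def one_ereal_def[symmetric])
next
  case False
  then have "p > 0" using assms by simp
  define k where "k = c powr p / Gamma (p + 1)"
  define h where "h = (\<lambda>r. ennreal (p * r powr (p - 1) * X r) * indicator {0<..} r)"
  have "k > 0" using c_pos \<open>p > 0\<close> by (simp add: k_def)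
  have G: "Gamma (p + 1) = p * Gamma p"
    using \<open>p > 0\<close> by (intro Gamma_plus1) auto
  have eq: "ennreal (gamma_density c p r * Z r) = ennreal k * h r" for r
    using \<open>p > 0\<close> Gamma_real_neq_0[of p] X_nonneg[of r] \<open>k > 0\<close>
    by (auto simp: gamma_density_def h_def indicator_def k_def G X_eq mult_ac simp flip: ennreal_mult')
  have "W p = (\<integral>\<^sup>+r. ennreal k * h r \<partial>lborel)"
    using False by (simp add: W_def eq)
  also have "\<dots> = ennreal k * (\<integral>\<^sup>+r. h r \<partial>lborel)"
  proof (rule nn_integral_cmult)
    \<comment> \<open>Measurability is inherited from the density times \<open>Z\<close>, by solving
      \<open>eq\<close> for \<open>h\<close>.\<close>
    have "h = (\<lambda>r. ennreal (1 / k) * ennreal (gamma_density c p r * Z r))"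
      using \<open>k > 0\<close> unfolding eq by (simp add: fun_eq_iff mult.assoc[symmetric] flip: ennreal_mult')
    then show "h \<in> borel_measurable lborel" by simp
  qed
  finally have "enn2ereal (W p) = ereal k * Y X p 0"
    using \<open>k > 0\<close> Y_pos[OF \<open>p > 0\<close>] by (simp add: times_ennreal.rep_eq h_def)
  also have "\<dots> = ereal (c powr p) * Y X p 0 / ereal (Gamma (p + 1))"
    using \<open>p > 0\<close> c_pos Gamma_real_neq_0[of "p + 1"] Gamma_real_pos[of "p + 1"]
    by (cases "Y X p 0") (auto simp: k_def divide_ereal_def field_simps)
  finally show ?thesis by simp
qed

section \<open>The limit for large shape\<close>

text \<open>Every mean is at least \<open>L\<close> because \<open>L\<close> bounds \<open>Z\<close>
  from below. For the upper bound \<open>R\<close> is chosen with \<open>Z R\<close> below the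
  target \<open>y\<close>, so the part beyond \<open>R\<close> is harmless whatever the
  shape.\<close>

lemma W_tendsto:
  assumes L: "(Z \<longlongrightarrow> L) at_top" and "p0 \<ge> 0" and fin: "W p0 < \<infinity>"
  shows "(W \<longlongrightarrow> ennreal L) at_top"
proof (rule order_tendstoI)
  have L_le: "L \<le> Z t" if "t > 0" for t
    using that
    by (intro tendsto_upperbound[OF L] eventually_mono[OF eventually_ge_at_top[of t]]) (auto intro: Z_antimono)
  have "L \<ge> 0"
    by (intro tendsto_lowerbound[OF L] eventually_mono[OF eventually_gt_at_top[of 0]]) (auto simp: Z_nonneg)
  fix y assume y: "y < ennreal L"
  have "ennreal L \<le> W p" if "p > 0" for p
  proof -
    have "ennreal L = (\<integral>\<^sup>+r. ennreal (gamma_density c p r * L) \<partial>lborel)"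
      using nn_integral_gamma_density_mult[OF c_pos that \<open>L \<ge> 0\<close>] by simp
    also have "\<dots> \<le> W p"
    proof -
      have "gamma_density c p r * L \<le> gamma_density c p r * Z r" for r
      proof (cases "r > 0")
        case True
        then show ?thesis using that by (intro mult_left_mono L_le gamma_density_nonneg)
      qed (simp add: gamma_density_def)
      then show ?thesis using that by (auto simp: W_def intro!: nn_integral_mono ennreal_leI)
    qed
    finally show ?thesis .
  qed
  then have lt: "y < W p" if "p > 0" for p using less_le_trans[OF y] that by simp
  from eventually_gt_at_top[of 0] show "\<forall>\<^sub>F p in at_top. y < W p"
    by eventually_elim (rule lt)
next
  fix y assume y: "ennreal L < y"
  have "((\<lambda>t. ennreal (Z t)) \<longlongrightarrow> ennreal L) at_top" using L by (rule tendsto_ennrealI)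
  then have "\<forall>\<^sub>F t in at_top. ennreal (Z t) < y" using y by (rule order_tendstoD)
  then have "\<forall>\<^sub>F t in at_top. t > 0 \<and> ennreal (Z t) < y"
    using eventually_gt_at_top[of 0] by eventually_elim simp
  then obtain R where R: "R > 0" "ennreal (Z R) < y"
    using eventually_happens'[OF trivial_limit_at_top_linorder] by blast
  \<comment> \<open>The reference shape \<open>q\<close> is a positive integer not below
    \<open>p0\<close>: its mean is finite by monotonicity, and \<open>Gamma (q + real n)\<close> is
    the factorial of \<open>m + n\<close>, at least n!.\<close>
  define m where "m = nat \<lceil>p0\<rceil>"
  define q where "q = real (Suc m)"
  have "p0 \<le> q" unfolding q_def m_def by linarith
  then have "q > 0" and Wq: "W q < \<infinity>"
    using W_antimono[OF \<open>p0 \<ge> 0\<close>] fin by (auto simp: q_def intro: le_less_trans)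
  \<comment> \<open>The quotient of the densities of shapes \<open>q + real n\<close> and
    \<open>q\<close> at \<open>r = R\<close>, its largest value on (0, R].\<close>
  define K where "K = (\<lambda>n. (c * R) ^ n * Gamma q / Gamma (q + real n))"
  have K_nonneg: "0 \<le> K n" for n
    using c_pos R \<open>q > 0\<close> by (simp add: K_def)
  have bound: "W (q + real n) \<le> ennreal (K n) * W q + ennreal (Z R)" for n
  proof -
    let ?g = "gamma_density c"
    have le: "?g (q + real n) r * Z r \<le> K n * (?g q r * Z r) + ?g (q + real n) r * Z R" for r
    proof (cases "r > 0")
      case True
      show ?thesis
      proof (cases "r \<le> R")
        case True
        have "?g (q + real n) r = (c * r) ^ n * Gamma q / Gamma (q + real n) * ?g q r"
          using \<open>r > 0\<close> c_pos \<open>q > 0\<close> gamma_density_ratio[of c q "real n" r]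
          by (cases "n = 0") (auto simp: powr_realpow Gamma_real_neq_0)
        also have "\<dots> \<le> K n * ?g q r"
          unfolding K_def using True \<open>r > 0\<close> c_pos \<open>q > 0\<close>
          by (intro mult_right_mono divide_right_mono power_mono) (auto simp: gamma_density_nonneg)
        finally have "?g (q + real n) r * Z r \<le> K n * ?g q r * Z r"
          using Z_nonneg[OF \<open>r > 0\<close>] by (rule mult_right_mono)
        moreover have "0 \<le> ?g (q + real n) r * Z R"
          using \<open>q > 0\<close> Z_nonneg[OF R(1)] by (simp add: gamma_density_nonneg)
        ultimately show ?thesis by (simp add: mult.assoc)
      next
        case False
        then have "?g (q + real n) r * Z r \<le> ?g (q + real n) r * Z R"
          using R \<open>q > 0\<close> by (intro mult_left_mono Z_antimono) (auto simp: gamma_density_nonneg)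
        moreover have "0 \<le> K n * (?g q r * Z r)"
          using K_nonneg[of n] \<open>q > 0\<close> Z_nonneg[OF \<open>r > 0\<close>] by (simp add: gamma_density_nonneg)
        ultimately show ?thesis by simp
      qed
    qed (simp add: gamma_density_def)
    have "ennreal (?g (q + real n) r * Z r)
        \<le> ennreal (K n) * ennreal (?g q r * Z r) + ennreal (?g (q + real n) r * Z R)" for r
    proof (cases "r > 0")
      case True
      then have "0 \<le> ?g q r * Z r" "0 \<le> ?g (q + real n) r * Z R"
        using \<open>q > 0\<close> Z_nonneg R(1) by (simp_all add: gamma_density_nonneg)
      then show ?thesis
        using ennreal_leI[OF le[of r]] K_nonneg[of n] by (simp add: ennreal_mult ennreal_plus)
    qed (simp add: gamma_density_def)
    then have "W (q + real n) \<le> (\<integral>\<^sup>+r. ennreal (K n) * ennreal (?g q r * Z r) + ennreal (?g (q + real n) r * Z R) \<partial>lborel)"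
      using \<open>q > 0\<close> by (simp add: W_def nn_integral_mono)
    also have "\<dots> = ennreal (K n) * W q + ennreal (Z R)"
      using \<open>q > 0\<close> nn_integral_gamma_density_mult[OF c_pos _ Z_nonneg[OF R(1)], of "q + real n"]
      by (simp add: nn_integral_add nn_integral_cmult W_def)
    finally show ?thesis .
  qed
  have "K \<longlonglongrightarrow> 0"
  proof (rule tendsto_sandwich[OF _ _ tendsto_const])
    show "\<forall>\<^sub>F n in sequentially. 0 \<le> K n" by (simp add: K_nonneg)
    show "\<forall>\<^sub>F n in sequentially. K n \<le> inverse (fact n) * (c * R) ^ n * Gamma q"
    proof (rule always_eventually, rule allI)
      fix n
      have "Gamma (q + real n) = fact (m + n)"
        using Gamma_fact[of "m + n", where ?'a = real] by (simp add: q_def add_ac)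
      moreover have "fact n \<le> (fact (m + n) :: real)" by (rule fact_mono) simp
      ultimately have "K n \<le> (c * R) ^ n * Gamma q / fact n"
        unfolding K_def using c_pos R \<open>q > 0\<close> by (intro divide_left_mono) auto
      then show "K n \<le> inverse (fact n) * (c * R) ^ n * Gamma q" by (simp add: field_simps)
    qed
    have "(\<lambda>n. inverse (fact n) * (c * R) ^ n) \<longlonglongrightarrow> 0"
      by (intro summable_LIMSEQ_zero summable_exp)
    then show "(\<lambda>n. inverse (fact n) * (c * R) ^ n * Gamma q) \<longlonglongrightarrow> 0"
      by (rule tendsto_mult_left_zero)
  qed
  \<comment> \<open>Finiteness of \<open>W q\<close> is essential here: an infinite factor would not
    be tamed by \<open>K n\<close> tending to 0.\<close>
  then have "(\<lambda>n. W q * ennreal (K n) + ennreal (Z R)) \<longlonglongrightarrow> W q * ennreal 0 + ennreal (Z R)"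
    using Wq by (intro tendsto_add ennreal_tendsto_cmult tendsto_ennrealI tendsto_const) auto
  then have "\<forall>\<^sub>F n in sequentially. ennreal (K n) * W q + ennreal (Z R) < y"
    using R(2) by (intro order_tendstoD) (auto simp: mult.commute)
  then obtain n where n: "ennreal (K n) * W q + ennreal (Z R) < y"
    using eventually_happens'[OF sequentially_bot] by blast
  \<comment> \<open>Since \<open>W\<close> is nonincreasing, a single good \<open>n\<close> settles
    all larger real shapes.\<close>
  have lt: "W p < y" if "p \<ge> q + real n" for p
    using W_antimono[of "q + real n" p] that \<open>q > 0\<close> bound[of n] n by force
  from eventually_ge_at_top[of "q + real n"] show "\<forall>\<^sub>F p in at_top. W p < y"
    by eventually_elim (rule lt)
qed

lemma Z_convergent: "\<exists>L. (Z \<longlongrightarrow> L) at_top \<and> 0 \<le> L"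
proof -
  define L where "L = (INF t\<in>{0<..}. Z t)"
  have bdd: "bdd_below (Z ` {0<..})"
    using Z_nonneg by (auto intro!: bdd_belowI[of _ 0])
  have "(Z \<longlongrightarrow> L) at_top"
  proof (rule order_tendstoI)
    fix y assume "y < L"
    then have lt: "y < Z t" if "t > 0" for t
      using that by (auto simp: L_def intro: less_le_trans[OF _ cINF_lower[OF bdd]])
    from eventually_gt_at_top[of 0] show "\<forall>\<^sub>F t in at_top. y < Z t"
      by eventually_elim (rule lt)
  next
    fix y assume "L < y"
    then obtain s where "s > 0" "Z s < y"
      unfolding L_def using cINF_less_iff[OF _ bdd] by auto
    then have lt: "Z t < y" if "t \<ge> s" for t using Z_antimono[of s t] that by simp
    from eventually_ge_at_top[of s] show "\<forall>\<^sub>F t in at_top. Z t < y"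
      by eventually_elim (rule lt)
  qed
  moreover have "0 \<le> L"
    unfolding L_def by (intro cINF_greatest) (auto simp: Z_nonneg)
  ultimately show ?thesis by blast
qed

section \<open>The equality case in terms of \<open>X\<close> and the transfer from \<open>W\<close>
  to \<open>Y\<close>\<close>

text \<open>The update \<open>X(0 := x0)\<close> encodes the convention that X(0) is the limit at 0.
  At \<open>t = 0\<close> the equation is trivial; for positive \<open>t\<close> it says that
  \<open>Z\<close> has the value \<open>x0\<close>.\<close>

lemma Z_const_iff:
  "(\<exists>k. \<forall>t>0. Z t = k) \<longleftrightarrow>
   (\<exists>x0. (X \<longlongrightarrow> x0) (at_right 0) \<and> (\<forall>t\<ge>0. (X(0 := x0)) t = exp (- (c * t)) * x0))"
proof
  assume "\<exists>k. \<forall>t>0. Z t = k"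
  then obtain k where k: "\<And>t. t > 0 \<Longrightarrow> X t = exp (- (c * t)) * k"
    using X_eq by metis
  have "((\<lambda>t. exp (- (c * t)) * k) \<longlongrightarrow> exp (- (c * 0)) * k) (at_right 0)"
    by (intro tendsto_intros)
  moreover have "\<forall>\<^sub>F t in at_right (0::real). 0 < t" by (rule eventually_at_right_less)
  then have "\<forall>\<^sub>F t in at_right 0. exp (- (c * t)) * k = X t"
    by eventually_elim (simp add: k)
  ultimately have "(X \<longlongrightarrow> k) (at_right 0)"
    using Lim_transform_eventually by fastforce
  with k show "\<exists>x0. (X \<longlongrightarrow> x0) (at_right 0) \<and> (\<forall>t\<ge>0. (X(0 := x0)) t = exp (- (c * t)) * x0)"
    by (intro exI[of _ k]) auto
next
  assume "\<exists>x0. (X \<longlongrightarrow> x0) (at_right 0) \<and> (\<forall>t\<ge>0. (X(0 := x0)) t = exp (- (c * t)) * x0)"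
  then obtain x0 where x0: "\<And>t. t \<ge> 0 \<Longrightarrow> (X(0 := x0)) t = exp (- (c * t)) * x0" by blast
  then have "Z t = x0" if "t > 0" for t
    using x0[of t] that by (simp add: Z_def exp_minus)
  then show "\<exists>k. \<forall>t>0. Z t = k" by blast
qed

lemma W_eq_iff:
  assumes "0 \<le> p" "p < q"
  shows "W q = W p \<and> W p < \<infinity> \<longleftrightarrow> (\<exists>k. \<forall>t>0. Z t = k)"
proof
  assume "\<exists>k. \<forall>t>0. Z t = k"
  then obtain k where "\<And>t. t > 0 \<Longrightarrow> Z t = k" by blast
  then have "W p = ennreal k" "W q = ennreal k" using assms by (auto intro: W_const)
  then show "W q = W p \<and> W p < \<infinity>" by simp
qed (use W_eq_imp_Z_const[OF assms] in blast)

lemma W_finite_if_Y_finite: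
  assumes "p \<ge> 0" "Y X p 0 < \<infinity>"
  shows "W p < \<infinity>"
proof (rule ccontr)
  assume "\<not> W p < \<infinity>"
  then have "ereal (c powr p) * Y X p 0 / ereal (Gamma (p + 1)) = \<infinity>"
    using normalized_Y_eq_W[OF assms(1)] by (simp add: not_less top_unique)
  then show False
    using assms c_pos Gamma_real_neq_0[of "p + 1"] Gamma_real_pos[of "p + 1"]
    by (cases "Y X p 0") (auto simp: divide_ereal_def)
qed

end

theorem theorem2p1:
  fixes c :: real and X :: "real \<Rightarrow> real"
  assumes "c > 0"
    and "\<And>t. t > 0 \<Longrightarrow> X t \<ge> 0"
    and "\<And>t. t > 0 \<Longrightarrow> X differentiable (at t)"
    and "\<And>t. t > 0 \<Longrightarrow> deriv X t \<le> 0"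
    and "\<And>t. t > 0 \<Longrightarrow> deriv (\<lambda>s. exp (c * s) * X s) t \<le> 0"
  shows "(\<forall>p1 p2. 0 \<le> p1 \<and> p1 < p2 \<longrightarrow>
            ereal (c powr p2) * Y X p2 0 / ereal (Gamma (p2 + 1))
              \<le> ereal (c powr p1) * Y X p1 0 / ereal (Gamma (p1 + 1)) \<and>
            ((ereal (c powr p2) * Y X p2 0 / ereal (Gamma (p2 + 1))
                = ereal (c powr p1) * Y X p1 0 / ereal (Gamma (p1 + 1)) \<and>
              ereal (c powr p1) * Y X p1 0 / ereal (Gamma (p1 + 1)) < \<infinity>)
             \<longleftrightarrow>
             (\<exists>x0::real. (X \<longlongrightarrow> x0) (at_right 0) \<and>
                (\<forall>t\<ge>0. (X(0 := x0)) t = exp (- (c * t)) * x0)))) \<and>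
         ((\<exists>p0\<ge>0. Y X p0 0 < \<infinity>) \<longrightarrow>
            (\<exists>L::real. ((\<lambda>t. exp (c * t) * X t) \<longlongrightarrow> L) at_top \<and>
               ((\<lambda>p. ereal (c powr p) * Y X p 0 / ereal (Gamma (p + 1))) \<longlongrightarrow> ereal L) at_top))"
proof -
  interpret exp_decay c X
    by (rule exp_decay.intro) (fact assms)+
  have fin: "enn2ereal w < \<infinity> \<longleftrightarrow> w < \<infinity>" for w
    by (cases w) auto
  show ?thesis
  proof (intro conjI allI impI; (elim conjE exE)?)
    fix p1 p2 :: real assume p: "0 \<le> p1" "p1 < p2"
    then have eq: "ereal (c powr p2) * Y X p2 0 / ereal (Gamma (p2 + 1)) = enn2ereal (W p2)"
      "ereal (c powr p1) * Y X p1 0 / ereal (Gamma (p1 + 1)) = enn2ereal (W p1)"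
      by (simp_all add: normalized_Y_eq_W)
    show "ereal (c powr p2) * Y X p2 0 / ereal (Gamma (p2 + 1))
        \<le> ereal (c powr p1) * Y X p1 0 / ereal (Gamma (p1 + 1))"
      unfolding eq using W_antimono[of p1 p2] p by (simp add: less_eq_ennreal.rep_eq)
    show "(ereal (c powr p2) * Y X p2 0 / ereal (Gamma (p2 + 1))
          = ereal (c powr p1) * Y X p1 0 / ereal (Gamma (p1 + 1)) \<and>
        ereal (c powr p1) * Y X p1 0 / ereal (Gamma (p1 + 1)) < \<infinity>) \<longleftrightarrow>
        (\<exists>x0::real. (X \<longlongrightarrow> x0) (at_right 0) \<and> (\<forall>t\<ge>0. (X(0 := x0)) t = exp (- (c * t)) * x0))"
      unfolding eq fin enn2ereal_inject W_eq_iff[OF p] Z_const_iff ..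
  next
    fix p0 :: real assume "0 \<le> p0" "Y X p0 0 < \<infinity>"
    then have "W p0 < \<infinity>" by (rule W_finite_if_Y_finite)
    obtain L where L: "(Z \<longlongrightarrow> L) at_top" "0 \<le> L" using Z_convergent by blast
    have "((\<lambda>p. enn2ereal (W p)) \<longlongrightarrow> enn2ereal (ennreal L)) at_top"
      using W_tendsto[OF L(1) \<open>0 \<le> p0\<close> \<open>W p0 < \<infinity>\<close>] by (rule tendsto_enn2erealI)
    moreover have "\<forall>\<^sub>F p in at_top. enn2ereal (W p) = ereal (c powr p) * Y X p 0 / ereal (Gamma (p + 1))"
      using eventually_ge_at_top[of 0] by eventually_elim (simp add: normalized_Y_eq_W)
    ultimately have "((\<lambda>p. ereal (c powr p) * Y X p 0 / ereal (Gamma (p + 1))) \<longlongrightarrow> enn2ereal (ennreal L)) at_top"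
      by (rule Lim_transform_eventually)
    with L show "\<exists>L::real. ((\<lambda>t. exp (c * t) * X t) \<longlongrightarrow> L) at_top \<and>
        ((\<lambda>p. ereal (c powr p) * Y X p 0 / ereal (Gamma (p + 1))) \<longlongrightarrow> ereal L) at_top"
      by (auto simp: Z_def[abs_def])
  qed
qed

end
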